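(* Let $$W=\begin{bmatrix} 1 & \frac{2}{\sqrt{6}} & 0 & 0 & \frac{1}{3}\\ \frac{2}{\sqrt{6}} & 1 & \frac{1}{2} & 0 & 0\\ 0 & \frac{1}{2} & 1 & \frac{1}{2} & 0\\ 0 & 0 & \frac{1}{2} & 1 & \frac{2}{\sqrt{6}}\\ \frac{1}{3} & 0 & 0 & \frac{2}{\sqrt{6}} & 1 \end{bmatrix},$$ with rows and columns indexed by $0,1,2,3,4$; that is, $W=[\langle v_i,v_j\rangle]_{i,j=0}^4$ for the vectors $v_0=\frac{1}{\sqrt3}(1,1,1)$, $v_1=\frac1{\sqrt2}(0,1,1)$, $v_2=\frac1{\sqrt2}(-1,0,1)$, $v_3=\frac1{\sqrt2}(0,-1,1)$, $v_4=\frac1{\sqrt3}(1,-1,1)$ in $\mathbb{R}^3$. Then there is no finite von Neumann algebra $(\mathcal{A},\tau)$ with positive operators $A_0,\dots,A_4\in\mathcal{A}$ such that $W_{ij}=\tau(A_iA_j)$ for all $i,j\in\{0,\dots,4\}$.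
   Context: A finite von Neumann algebra $(\mathcal{A},\tau)$ means a von Neumann algebra $\mathcal{A}$ equipped with a faithful normal (finite) trace $\tau$. *)

theory Defs
  imports "HOL-Analysis.Analysis"
begin

section \<open>Complex Hilbert spaces\<close>

text \<open>
  The inner product is linear in its first argument. Positive definiteness is contained in
  the last axiom, because the norm of a real normed vector space is definite.
\<close>

class complex_hilbert_space = real_normed_vector + complete_space +
  fixes scaleC :: "complex \<Rightarrow> 'a \<Rightarrow> 'a" (infixr \<open>*\<^sub>C\<close> 75)
    and cinner :: "'a \<Rightarrow> 'a \<Rightarrow> complex"
  assumes scaleC_add_right: "c *\<^sub>C (x + y) = c *\<^sub>C x + c *\<^sub>C y"
    and scaleC_add_left: "(c + d) *\<^sub>C x = c *\<^sub>C x + d *\<^sub>C x"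
    and scaleC_scaleC: "c *\<^sub>C d *\<^sub>C x = (c * d) *\<^sub>C x"
    and scaleC_of_real: "complex_of_real r *\<^sub>C x = r *\<^sub>R x"
    and cinner_add_left: "cinner (x + y) z = cinner x z + cinner y z"
    and cinner_scaleC_left: "cinner (c *\<^sub>C x) y = c * cinner x y"
    and cinner_commute: "cinner x y = cnj (cinner y x)"
    and cinner_same: "cinner x x = complex_of_real ((norm x)\<^sup>2)"

lemma cinner_scaleC_right: "cinner x (c *\<^sub>C y) = cnj c * cinner x y"
  by (metis cinner_commute cinner_scaleC_left complex_cnj_mult)

lemma norm_scaleC: "norm (c *\<^sub>C x) = cmod c * norm x"
proof -
  have "complex_of_real ((norm (c *\<^sub>C x))\<^sup>2) = c * cnj c * complex_of_real ((norm x)\<^sup>2)"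
    by (simp only: cinner_same [symmetric] cinner_scaleC_left cinner_scaleC_right mult_ac)
  also have "\<dots> = complex_of_real ((cmod c * norm x)\<^sup>2)"
    by (simp only: complex_norm_square [symmetric] power_mult_distrib of_real_mult)
  finally have "(norm (c *\<^sub>C x))\<^sup>2 = (cmod c * norm x)\<^sup>2"
    using of_real_eq_iff by blast
  then show ?thesis
    by simp
qed

lemma bounded_linear_scaleC: "bounded_linear (\<lambda>x. c *\<^sub>C (x :: 'a :: complex_hilbert_space))"
proof
  show "c *\<^sub>C (x + y) = c *\<^sub>C x + c *\<^sub>C y" for x y :: 'a
    by (rule scaleC_add_right)
  show "c *\<^sub>C (r *\<^sub>R x) = r *\<^sub>R (c *\<^sub>C x)" for r and x :: 'a
    by (simp add: scaleC_of_real [symmetric] scaleC_scaleC mult.commute)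
  show "\<exists>K. \<forall>x :: 'a. norm (c *\<^sub>C x) \<le> norm x * K"
    by (auto simp: norm_scaleC intro: exI [of _ "cmod c"])
qed

instantiation complex :: complex_hilbert_space
begin

definition "scaleC_complex = ((*) :: complex \<Rightarrow> complex \<Rightarrow> complex)"

definition "cinner_complex (x :: complex) y = x * cnj y"

instance
proof
  show "cinner x x = complex_of_real ((norm x)\<^sup>2)" for x :: complex
    unfolding cinner_complex_def by (rule complex_norm_square [symmetric])
qed (simp_all add: scaleC_complex_def cinner_complex_def distrib_left distrib_right
      scaleR_conv_of_real)

end

section \<open>Bounded operators\<close>

text \<open>
  The library type of bounded linear maps consists of the real-linear ones; the bounded
  operators on the complex Hilbert space are its complex-linear elements.
\<close>

definition bounded_operators :: "('h::complex_hilbert_space \<Rightarrow>\<^sub>L 'h) set" where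
  "bounded_operators = {T. \<forall>c x. blinfun_apply T (c *\<^sub>C x) = c *\<^sub>C blinfun_apply T x}"

lift_definition scaleC_op ::
  "complex \<Rightarrow> ('h::complex_hilbert_space \<Rightarrow>\<^sub>L 'h) \<Rightarrow> ('h \<Rightarrow>\<^sub>L 'h)"
  is "\<lambda>c T x. c *\<^sub>C T x"
  by (rule bounded_linear_compose [OF bounded_linear_scaleC])

definition is_adjoint ::
  "('h::complex_hilbert_space \<Rightarrow>\<^sub>L 'h) \<Rightarrow> ('h \<Rightarrow>\<^sub>L 'h) \<Rightarrow> bool" where
  "is_adjoint S T \<longleftrightarrow>
    (\<forall>x y. cinner (blinfun_apply S x) y = cinner x (blinfun_apply T y))"

definition positive_operator :: "('h::complex_hilbert_space \<Rightarrow>\<^sub>L 'h) \<Rightarrow> bool" where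
  "positive_operator T \<longleftrightarrow>
    T \<in> bounded_operators \<and> (\<forall>x. cinner (blinfun_apply T x) x \<in> \<real>\<^sub>\<ge>\<^sub>0)"

definition operator_le ::
  "('h::complex_hilbert_space \<Rightarrow>\<^sub>L 'h) \<Rightarrow> ('h \<Rightarrow>\<^sub>L 'h) \<Rightarrow> bool" where
  "operator_le S T \<longleftrightarrow> positive_operator (T - S)"

section \<open>Finite von Neumann algebras\<close>

text \<open>
  A von Neumann algebra is a unital *-subalgebra of the bounded operators that is closed in
  the strong operator topology. The library topology lives on the real-linear maps, in which
  the complex-linear ones form a closed set, so closedness is the same in either space.
\<close>

definition von_neumann_algebra :: "('h::complex_hilbert_space \<Rightarrow>\<^sub>L 'h) set \<Rightarrow> bool" where
  "von_neumann_algebra M \<longleftrightarrow>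
    M \<subseteq> bounded_operators \<and>
    id_blinfun \<in> M \<and>
    (\<forall>S\<in>M. \<forall>T\<in>M. S + T \<in> M) \<and>
    (\<forall>c. \<forall>T\<in>M. scaleC_op c T \<in> M) \<and>
    (\<forall>S\<in>M. \<forall>T\<in>M. S o\<^sub>L T \<in> M) \<and>
    (\<forall>T\<in>M. \<exists>S\<in>M. is_adjoint S T) \<and>
    closedin strong_operator_topology M"

text \<open>
  Functionals on \<open>M\<close> are functions on all operators of which only the values on \<open>M\<close> matter.
  A trace takes finite values and is not assumed to satisfy \<open>\<tau> id_blinfun = 1\<close>.
\<close>

definition trace_on ::
  "('h::complex_hilbert_space \<Rightarrow>\<^sub>L 'h) set \<Rightarrow> (('h \<Rightarrow>\<^sub>L 'h) \<Rightarrow> complex) \<Rightarrow> bool" where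
  "trace_on M \<tau> \<longleftrightarrow>
    (\<forall>S\<in>M. \<forall>T\<in>M. \<tau> (S + T) = \<tau> S + \<tau> T) \<and>
    (\<forall>c. \<forall>T\<in>M. \<tau> (scaleC_op c T) = c * \<tau> T) \<and>
    (\<forall>T\<in>M. positive_operator T \<longrightarrow> \<tau> T \<in> \<real>\<^sub>\<ge>\<^sub>0) \<and>
    (\<forall>S\<in>M. \<forall>T\<in>M. \<tau> (S o\<^sub>L T) = \<tau> (T o\<^sub>L S))"

definition faithful_on ::
  "('h::complex_hilbert_space \<Rightarrow>\<^sub>L 'h) set \<Rightarrow> (('h \<Rightarrow>\<^sub>L 'h) \<Rightarrow> complex) \<Rightarrow> bool" where
  "faithful_on M \<tau> \<longleftrightarrow> (\<forall>T\<in>M. positive_operator T \<and> \<tau> T = 0 \<longrightarrow> T = 0)"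

definition is_supremum_in ::
  "('h::complex_hilbert_space \<Rightarrow>\<^sub>L 'h) set \<Rightarrow> ('h \<Rightarrow>\<^sub>L 'h) set \<Rightarrow> ('h \<Rightarrow>\<^sub>L 'h) \<Rightarrow> bool" where
  "is_supremum_in M D s \<longleftrightarrow>
    s \<in> M \<and> (\<forall>T\<in>D. operator_le T s) \<and>
    (\<forall>u\<in>M. (\<forall>T\<in>D. operator_le T u) \<longrightarrow> operator_le s u)"

text \<open>
  Bounded increasing nets of positive elements are represented by their ranges, which are
  upward directed sets. The traces occurring below are nonnegative reals, bounded above by
  the trace of \<open>s\<close>.
\<close>

definition normal_on ::
  "('h::complex_hilbert_space \<Rightarrow>\<^sub>L 'h) set \<Rightarrow> (('h \<Rightarrow>\<^sub>L 'h) \<Rightarrow> complex) \<Rightarrow> bool" where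
  "normal_on M \<tau> \<longleftrightarrow>
    (\<forall>D s. D \<noteq> {} \<and> D \<subseteq> M \<and> (\<forall>T\<in>D. positive_operator T) \<and>
      (\<forall>S\<in>D. \<forall>T\<in>D. \<exists>R\<in>D. operator_le S R \<and> operator_le T R) \<and>
      is_supremum_in M D s \<longrightarrow>
      Re (\<tau> s) = (SUP T\<in>D. Re (\<tau> T)))"

definition finite_von_neumann_algebra ::
  "('h::complex_hilbert_space \<Rightarrow>\<^sub>L 'h) set \<Rightarrow> (('h \<Rightarrow>\<^sub>L 'h) \<Rightarrow> complex) \<Rightarrow> bool" where
  "finite_von_neumann_algebra M \<tau> \<longleftrightarrow>
    von_neumann_algebra M \<and> trace_on M \<tau> \<and> faithful_on M \<tau> \<and> normal_on M \<tau>"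

section \<open>The matrix and its Gram vectors\<close>

text \<open>
  Rows, columns and vectors are indexed by \<open>0, \<dots>, 4\<close>.
\<close>

definition W :: "nat \<Rightarrow> nat \<Rightarrow> real" where
  "W i j =
    [[1, 2 / sqrt 6, 0, 0, 1 / 3],
     [2 / sqrt 6, 1, 1 / 2, 0, 0],
     [0, 1 / 2, 1, 1 / 2, 0],
     [0, 0, 1 / 2, 1, 2 / sqrt 6],
     [1 / 3, 0, 0, 2 / sqrt 6, 1]] ! i ! j"

definition v :: "nat \<Rightarrow> real ^ 3" where
  "v i =
    [(1 / sqrt 3) *\<^sub>R vector [1, 1, 1],
     (1 / sqrt 2) *\<^sub>R vector [0, 1, 1],
     (1 / sqrt 2) *\<^sub>R vector [-1, 0, 1],
     (1 / sqrt 2) *\<^sub>R vector [0, -1, 1],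
     (1 / sqrt 3) *\<^sub>R vector [1, -1, 1]] ! i"

end

theory Submission
  imports Defs
begin

text \<open>
  Write \<open>t T = Re (\<tau> T)\<close>. Since \<open>W\<close> is the Gram matrix of the \<open>v i\<close> and \<open>\<tau>\<close> is faithful,
  every linear relation among the vectors \<open>v i\<close> also holds among the operators \<open>A i\<close>; and
  since positive operators with \<open>\<tau> (S T) = 0\<close> satisfy \<open>S T = 0\<close>, the zero pattern of \<open>W\<close>
  holds for the products. Multiplying the relation expressing \<open>A 1\<close> through
  \<open>A 0, A 2, A 3\<close> by \<open>A 3\<close>, and the one expressing \<open>A 4\<close> by \<open>A 2\<close>, gives
  \<open>2 A 2 A 3 = (A 3)\<^sup>2\<close> and \<open>2 A 3 A 2 = (A 2)\<^sup>2\<close>. With the adjoints of these identities,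
  \<open>(A 2)^3 = 0\<close>, contradicting \<open>\<tau> ((A 2)\<^sup>2) = 1\<close>.
\<close>

section \<open>Positive operators\<close>

lemma cinner_add_right: "cinner x (y + z) = cinner x y + cinner x z"
  by (metis cinner_commute cinner_add_left complex_cnj_add)

lemma cinner_minus_left: "cinner (- x) y = - cinner x y"
  by (metis add.right_inverse add_eq_0_iff cinner_add_left add_cancel_right_left)

lemma cinner_minus_right: "cinner x (- y) = - cinner x y"
  by (metis cinner_commute cinner_minus_left complex_cnj_minus)

lemma cinner_diff_left: "cinner (x - y) z = cinner x z - cinner y z"
  using cinner_add_left[of x "- y" z] by (simp add: cinner_minus_left)

lemma cinner_diff_right: "cinner x (y - z) = cinner x y - cinner x z"
  using cinner_add_right[of x y "- z"] by (simp add: cinner_minus_right)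

lemma cinner_scaleR_left: "cinner (r *\<^sub>R x) y = complex_of_real r * cinner x y"
  by (metis cinner_scaleC_left scaleC_of_real)

lemma cinner_scaleR_right: "cinner x (r *\<^sub>R y) = complex_of_real r * cinner x y"
  by (metis cinner_scaleC_right scaleC_of_real complex_cnj_complex_of_real)

lemma scaleC_diff_right: "c *\<^sub>C (x - y) = c *\<^sub>C x - c *\<^sub>C y"
  by (metis add_diff_cancel_right' diff_add_cancel scaleC_add_right)

lemma scaleC_scaleR_commute: "c *\<^sub>C (r *\<^sub>R x) = r *\<^sub>R (c *\<^sub>C x)"
  by (simp add: scaleC_of_real[symmetric] scaleC_scaleC mult.commute)

lemma blinfun_compose_assoc: "(R o\<^sub>L S) o\<^sub>L T = R o\<^sub>L (S o\<^sub>L T)"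
  by (rule blinfun_eqI) simp

lemma blinfun_compose_id_right: "T o\<^sub>L id_blinfun = T"
  by (rule blinfun_eqI) simp

lemmas blinfun_compose_linear =
  bounded_bilinear.add_left [OF bounded_bilinear_blinfun_compose]
  bounded_bilinear.add_right [OF bounded_bilinear_blinfun_compose]
  bounded_bilinear.diff_left [OF bounded_bilinear_blinfun_compose]
  bounded_bilinear.diff_right [OF bounded_bilinear_blinfun_compose]
  bounded_bilinear.scaleR_left [OF bounded_bilinear_blinfun_compose]
  bounded_bilinear.scaleR_right [OF bounded_bilinear_blinfun_compose]
  bounded_bilinear.sum_left [OF bounded_bilinear_blinfun_compose]
  bounded_bilinear.sum_right [OF bounded_bilinear_blinfun_compose]

lemma scaleC_op_of_real: "scaleC_op (complex_of_real r) T = r *\<^sub>R T"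
  by (rule blinfun_eqI) (simp add: scaleC_op.rep_eq scaleC_of_real blinfun.scaleR_left)

text \<open>Expand \<open>(norm (x - y))\<^sup>2\<close>, which is nonnegative. This weak form of
  Cauchy-Schwarz is enough to compare an operator of norm at most 1 with the identity.\<close>

lemma Re_cinner_le: "2 * Re (cinner x y) \<le> (norm x)\<^sup>2 + (norm y)\<^sup>2"
proof -
  have "complex_of_real ((norm (x - y))\<^sup>2)
      = complex_of_real ((norm x)\<^sup>2) + complex_of_real ((norm y)\<^sup>2) - (cinner x y + cnj (cinner x y))"
    using cinner_commute[of y x]
    by (simp only: cinner_same[symmetric] cinner_diff_left cinner_diff_right) simp
  then have "(norm (x - y))\<^sup>2 = (norm x)\<^sup>2 + (norm y)\<^sup>2 - 2 * Re (cinner x y)"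
    by (simp add: complex_eq_iff)
  then show ?thesis
    by (smt (verit) zero_le_power2)
qed

lemma bounded_operators_id: "id_blinfun \<in> bounded_operators"
  and bounded_operators_scaleR: "T \<in> bounded_operators \<Longrightarrow> r *\<^sub>R T \<in> bounded_operators"
  and bounded_operators_add:
    "S \<in> bounded_operators \<Longrightarrow> T \<in> bounded_operators \<Longrightarrow> S + T \<in> bounded_operators"
  and bounded_operators_diff:
    "S \<in> bounded_operators \<Longrightarrow> T \<in> bounded_operators \<Longrightarrow> S - T \<in> bounded_operators"
  and bounded_operators_compose:
    "S \<in> bounded_operators \<Longrightarrow> T \<in> bounded_operators \<Longrightarrow> S o\<^sub>L T \<in> bounded_operators"
  by (auto simp: bounded_operators_def blinfun.add_left blinfun.diff_left blinfun.scaleR_left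
      scaleC_add_right scaleC_diff_right scaleC_scaleR_commute)

lemmas bounded_operators_closed =
  bounded_operators_id bounded_operators_scaleR bounded_operators_add
  bounded_operators_diff bounded_operators_compose

section \<open>Positivity and adjoints\<close>

lemma positive_operatorD:
  assumes "positive_operator T"
  shows "T \<in> bounded_operators" "Im (cinner (blinfun_apply T x) x) = 0"
  using assms by (auto simp: positive_operator_def complex_nonneg_Reals_iff)

lemma positive_operator_add:
  "positive_operator S \<Longrightarrow> positive_operator T \<Longrightarrow> positive_operator (S + T)"
  by (simp add: positive_operator_def bounded_operators_closed blinfun.add_left cinner_add_left
      nonneg_Reals_add_I)

lemma positive_operator_scaleR:
  "positive_operator T \<Longrightarrow> 0 \<le> r \<Longrightarrow> positive_operator (r *\<^sub>R T)"
  by (simp add: positive_operator_def bounded_operators_closed blinfun.scaleR_left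
      cinner_scaleR_left nonneg_Reals_mult_I)

text \<open>Polarization: the form of \<open>T\<close> is real on the diagonal. Evaluating it at
  \<open>x + y\<close> fixes the imaginary parts of the mixed terms, and at
  \<open>x + \<i> *\<^sub>C y\<close> the real parts.\<close>

lemma positive_operator_self_adjoint:
  assumes "positive_operator T"
  shows "is_adjoint T T"
  unfolding is_adjoint_def
proof (intro allI)
  fix x y
  define s where "s = (\<lambda>x y. cinner (blinfun_apply T x) y)"
  have lin: "blinfun_apply T (c *\<^sub>C z) = c *\<^sub>C blinfun_apply T z" for c z
    using assms by (auto simp: positive_operator_def bounded_operators_def)
  have real: "Im (s z z) = 0" for z
    using positive_operatorD(2)[OF assms] by (simp add: s_def)
  have "s (x + y) (x + y) = s x x + s x y + s y x + s y y"
    by (simp add: s_def blinfun.add_right cinner_add_left cinner_add_right)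
  then have 1: "Im (s x y) + Im (s y x) = 0"
    using real[of "x + y"] real[of x] real[of y] by simp
  have "s (x + \<i> *\<^sub>C y) (x + \<i> *\<^sub>C y) = s x x - \<i> * s x y + \<i> * s y x + s y y"
    by (simp add: s_def blinfun.add_right lin cinner_add_left cinner_add_right
        cinner_scaleC_left cinner_scaleC_right algebra_simps)
  then have 2: "Re (s y x) = Re (s x y)"
    using real[of "x + \<i> *\<^sub>C y"] real[of x] real[of y] by simp
  have "s x y = cnj (s y x)"
    using 1 2 by (simp add: complex_eq_iff)
  then show "cinner (blinfun_apply T x) y = cinner x (blinfun_apply T y)"
    by (metis s_def cinner_commute)
qed

lemma positive_operator_conjugate:
  assumes "positive_operator T" "S \<in> bounded_operators" "is_adjoint R S" "R \<in> bounded_operators"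
  shows "positive_operator (R o\<^sub>L T o\<^sub>L S)"
  using assms by (auto simp: positive_operator_def is_adjoint_def bounded_operators_closed)

lemma positive_operator_square:
  assumes "S \<in> bounded_operators" "is_adjoint R S" "R \<in> bounded_operators"
  shows "positive_operator (R o\<^sub>L S)"
proof -
  have "positive_operator id_blinfun"
    by (simp add: positive_operator_def bounded_operators_closed cinner_same
        bounded_operators_def del: of_real_power)
  from positive_operator_conjugate[OF this assms] show ?thesis
    by (metis blinfun_compose_id_right)
qed

text \<open>The squared norm of \<open>S x\<close> is the inner product of \<open>R (S x)\<close>
  with \<open>x\<close>.\<close>

lemma adjoint_compose_eq_0D:
  assumes "is_adjoint R S" "R o\<^sub>L S = 0"
  shows "S = 0"
proof (rule blinfun_eqI)
  fix x
  have "cinner (blinfun_apply S x) (blinfun_apply S x) = cinner (blinfun_apply (R o\<^sub>L S) x) x"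
    using assms(1) by (simp add: is_adjoint_def)
  also have "\<dots> = 0"
    using assms(2) cinner_scaleR_left[of 0 0 x] by simp
  finally show "blinfun_apply S x = blinfun_apply 0 x"
    by (simp add: cinner_same)
qed

lemma is_adjoint_compose:
  "is_adjoint R S \<Longrightarrow> is_adjoint R' S' \<Longrightarrow> is_adjoint (R o\<^sub>L R') (S' o\<^sub>L S)"
  by (simp add: is_adjoint_def)

lemma is_adjoint_unique:
  assumes "is_adjoint R S" "is_adjoint R T"
  shows "S = T"
proof (rule blinfun_eqI)
  fix x
  have "cinner y (blinfun_apply S x - blinfun_apply T x) = 0" for y
    using assms by (simp add: is_adjoint_def cinner_diff_right)
  from this[of "blinfun_apply S x - blinfun_apply T x"]
  show "blinfun_apply S x = blinfun_apply T x"
    by (simp add: cinner_same)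
qed

lemma is_adjoint_id: "is_adjoint id_blinfun id_blinfun"
  by (simp add: is_adjoint_def)

lemma is_adjoint_add:
  "is_adjoint R S \<Longrightarrow> is_adjoint R' S' \<Longrightarrow> is_adjoint (R + R') (S + S')"
  by (simp add: is_adjoint_def blinfun.add_left cinner_add_left cinner_add_right)

lemma is_adjoint_scaleR: "is_adjoint R S \<Longrightarrow> is_adjoint (r *\<^sub>R R) (r *\<^sub>R S)"
  by (simp add: is_adjoint_def blinfun.scaleR_left cinner_scaleR_left cinner_scaleR_right)

lemma is_adjoint_zero: "is_adjoint 0 0"
  using is_adjoint_scaleR[OF is_adjoint_id, of 0] by simp

text \<open>The operators between 0 and the identity. They are stable under subtracting the square,
  so squares can do the work usually done by square roots.\<close>

definition unit_interval :: "('h::complex_hilbert_space \<Rightarrow>\<^sub>L 'h) \<Rightarrow> bool" where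
  "unit_interval T \<longleftrightarrow> positive_operator T \<and> positive_operator (id_blinfun - T)"

lemma unit_intervalI:
  assumes "positive_operator T" "norm T \<le> 1"
  shows "unit_interval T"
proof -
  have "cinner (blinfun_apply (id_blinfun - T) x) x \<in> \<real>\<^sub>\<ge>\<^sub>0" for x
  proof -
    have "norm (blinfun_apply T x) \<le> norm x"
      using norm_blinfun[of T x] assms(2) by (meson mult_left_le_one_le norm_ge_zero order_trans)
    then have "(norm (blinfun_apply T x))\<^sup>2 \<le> (norm x)\<^sup>2"
      by (simp add: power_mono)
    then have "Re (cinner (blinfun_apply T x) x) \<le> (norm x)\<^sup>2"
      using Re_cinner_le[of "blinfun_apply T x" x] by linarith
    then show ?thesis
      using positive_operatorD(2)[OF assms(1), of x]
      by (simp add: blinfun.diff_left cinner_diff_left cinner_same complex_nonneg_Reals_iff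
          del: of_real_power)
  qed
  then show ?thesis
    using assms(1) unfolding unit_interval_def positive_operator_def
    by (auto intro: bounded_operators_closed)
qed

text \<open>Dividing by \<open>1 + norm T\<close> rather than by the norm covers
  \<open>T = 0\<close> as well.\<close>

lemma obtain_unit_interval_scaling:
  assumes "positive_operator T"
  obtains r where "r > 0" "unit_interval (r *\<^sub>R T)"
proof (rule that[of "1 / (1 + norm T)"])
  have "0 < 1 + norm T"
    by (simp add: add_pos_nonneg)
  then show "0 < 1 / (1 + norm T)" by simp
  show "unit_interval ((1 / (1 + norm T)) *\<^sub>R T)"
    using \<open>0 < 1 + norm T\<close> by (intro unit_intervalI positive_operator_scaleR assms) auto
qed

text \<open>With \<open>U\<close> the identity minus \<open>T\<close>, the two operators commute and
  add up to the identity. Hence \<open>T - T^2 = T U = T U T + U T U\<close>, a sum of conjugates of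
  positive operators, and its complement is \<open>U + T^2\<close>.\<close>

lemma unit_interval_diff_square:
  assumes "unit_interval T"
  shows "unit_interval (T - (T o\<^sub>L T))"
proof -
  let ?U = "id_blinfun - T"
  have T: "positive_operator T" "positive_operator ?U"
    using assms by (auto simp: unit_interval_def)
  note sa = T[THEN positive_operator_self_adjoint] and bd = T[THEN positive_operatorD(1)]
  have "T - (T o\<^sub>L T) = (T o\<^sub>L ?U o\<^sub>L T) + (?U o\<^sub>L T o\<^sub>L ?U)"
    by (rule blinfun_eqI) (simp add: blinfun.add_left blinfun.diff_left blinfun.diff_right)
  then have "positive_operator (T - (T o\<^sub>L T))"
    using T sa bd by (simp add: positive_operator_add positive_operator_conjugate)
  moreover have "id_blinfun - (T - (T o\<^sub>L T)) = ?U + (T o\<^sub>L T)"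
    by simp
  then have "positive_operator (id_blinfun - (T - (T o\<^sub>L T)))"
    using T sa bd by (metis positive_operator_add positive_operator_square)
  ultimately show ?thesis
    by (simp add: unit_interval_def)
qed

section \<open>Faithful traces\<close>

locale finite_vna =
  fixes M :: "('h::complex_hilbert_space \<Rightarrow>\<^sub>L 'h) set" and \<tau> :: "('h \<Rightarrow>\<^sub>L 'h) \<Rightarrow> complex"
  assumes finite_vna: "finite_von_neumann_algebra M \<tau>"
begin

text \<open>Passing to the real part makes inequalities available and loses nothing on positive
  elements, where \<open>\<tau>\<close> is already real.\<close>

definition t :: "('h \<Rightarrow>\<^sub>L 'h) \<Rightarrow> real" where
  "t T = Re (\<tau> T)"

lemma M_bounded: "T \<in> M \<Longrightarrow> T \<in> bounded_operators"
  and M_id: "id_blinfun \<in> M"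
  and M_add: "S \<in> M \<Longrightarrow> T \<in> M \<Longrightarrow> S + T \<in> M"
  and M_scaleC: "T \<in> M \<Longrightarrow> scaleC_op c T \<in> M"
  and M_compose: "S \<in> M \<Longrightarrow> T \<in> M \<Longrightarrow> S o\<^sub>L T \<in> M"
  using finite_vna unfolding finite_von_neumann_algebra_def von_neumann_algebra_def by auto

lemma M_scaleR: "T \<in> M \<Longrightarrow> r *\<^sub>R T \<in> M"
  by (metis M_scaleC scaleC_op_of_real)

lemma M_diff: "S \<in> M \<Longrightarrow> T \<in> M \<Longrightarrow> S - T \<in> M"
  using M_add[of S "(-1) *\<^sub>R T"] M_scaleR[of T "-1"] by simp

lemma M_zero: "0 \<in> M"
  using M_scaleR[OF M_id, of 0] by simp

lemma M_sum: "finite I \<Longrightarrow> (\<And>i. i \<in> I \<Longrightarrow> A i \<in> M) \<Longrightarrow> sum A I \<in> M"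
  by (induction I rule: finite_induct) (auto intro: M_add M_zero)

lemmas M_closed = M_id M_add M_scaleR M_compose M_diff M_zero M_sum

lemma t_add: "S \<in> M \<Longrightarrow> T \<in> M \<Longrightarrow> t (S + T) = t S + t T"
  and t_compose_commute: "S \<in> M \<Longrightarrow> T \<in> M \<Longrightarrow> t (S o\<^sub>L T) = t (T o\<^sub>L S)"
  and t_nonneg: "T \<in> M \<Longrightarrow> positive_operator T \<Longrightarrow> t T \<ge> 0"
  using finite_vna unfolding finite_von_neumann_algebra_def trace_on_def t_def
  by (auto simp: complex_nonneg_Reals_iff)

lemma t_scaleR: "T \<in> M \<Longrightarrow> t (r *\<^sub>R T) = r * t T"
  using finite_vna unfolding finite_von_neumann_algebra_def trace_on_def t_def
  by (simp flip: scaleC_op_of_real)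

lemma t_diff: "S \<in> M \<Longrightarrow> T \<in> M \<Longrightarrow> t (S - T) = t S - t T"
  using t_add[of S "(-1) *\<^sub>R T"] M_scaleR[of T "-1"] t_scaleR[of T "-1"] by simp

lemma t_zero: "t 0 = 0"
  using t_scaleR[OF M_id, of 0] by simp

lemma t_sum: "finite I \<Longrightarrow> (\<And>i. i \<in> I \<Longrightarrow> A i \<in> M) \<Longrightarrow> t (sum A I) = (\<Sum>i\<in>I. t (A i))"
  by (induction I rule: finite_induct) (auto simp: t_zero t_add M_sum)

lemma t_faithful:
  assumes "T \<in> M" "positive_operator T" "t T = 0"
  shows "T = 0"
proof -
  have "\<tau> T \<in> \<real>\<^sub>\<ge>\<^sub>0"
    using finite_vna assms unfolding finite_von_neumann_algebra_def trace_on_def by auto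
  then have "\<tau> T = 0"
    using assms(3) by (simp add: t_def complex_nonneg_Reals_iff complex_eq_iff)
  then show ?thesis
    using finite_vna assms unfolding finite_von_neumann_algebra_def faithful_on_def by auto
qed

lemma t_square_faithful:
  assumes "S \<in> M" "R \<in> M" "is_adjoint R S" "t (R o\<^sub>L S) = 0"
  shows "S = 0"
  using assms by (meson M_bounded M_compose adjoint_compose_eq_0D positive_operator_square t_faithful)

lemma t_square_nonneg:
  "S \<in> M \<Longrightarrow> is_adjoint S S \<Longrightarrow> t (S o\<^sub>L S) \<ge> 0"
  by (simp add: M_bounded M_compose positive_operator_square t_nonneg)

section \<open>Traces of products of two positive operators\<close>

lemma t_compose_nonneg_unit:
  assumes A: "A \<in> M" "positive_operator A" and C: "C \<in> M" "unit_interval C"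
  shows "t (A o\<^sub>L C) \<ge> 0"
proof -
  txt \<open>
    Subtracting squares repeatedly exhausts \<open>C\<close>: the remainders \<open>c n\<close> stay in the unit
    interval, and \<open>C = (\<Sum>k<n. (c k)\<^sup>2) + c n\<close>, so that \<open>t ((c n)\<^sup>2)\<close> is summable.
  \<close>
  define c where "c n = ((\<lambda>T. T - (T o\<^sub>L T)) ^^ n) C" for n
  have c0: "c 0 = C" and cSuc: "c (Suc n) = c n - (c n o\<^sub>L c n)" for n
    by (simp_all add: c_def)
  have cM: "c n \<in> M" for n
    by (induction n) (simp_all add: c0 cSuc C M_closed)
  have cu: "unit_interval (c n)" for n
    by (induction n) (simp_all add: c0 cSuc C unit_interval_diff_square)
  then have cpos: "positive_operator (c n)" for n
    by (simp add: unit_interval_def)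
  note csa = cpos[THEN positive_operator_self_adjoint]
  have sq: "t (c n o\<^sub>L c n) \<ge> 0" for n
    by (rule t_square_nonneg[OF cM csa])
  have sum_eq: "(\<Sum>k<n. t (c k o\<^sub>L c k)) = t C - t (c n)" for n
    by (induction n) (simp_all add: c0 cSuc t_diff cM M_compose)
  have "(\<Sum>k<n. t (c k o\<^sub>L c k)) \<le> t C" for n
    using t_nonneg[OF cM cpos, of n] by (simp add: sum_eq)
  then have "summable (\<lambda>k. t (c k o\<^sub>L c k))"
    by (intro summableI_nonneg_bounded[where x = "t C"] sq)
  then have lim: "(\<lambda>k. t (c k o\<^sub>L c k)) \<longlonglongrightarrow> 0"
    by (rule summable_LIMSEQ_zero)
  \<comment> \<open>Each step from \<open>c n\<close> to \<open>c (Suc n)\<close> removes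
    \<open>t (A (c n)^2)\<close>, which by the trace property is \<open>t (c n A c n)\<close>, the
    trace of a conjugate of \<open>A\<close>.\<close>
  have decr: "t (A o\<^sub>L c n) \<le> t (A o\<^sub>L C)" for n
  proof (induction n)
    case (Suc n)
    have "t (A o\<^sub>L (c n o\<^sub>L c n)) = t (c n o\<^sub>L A o\<^sub>L c n)"
      using t_compose_commute[of "A o\<^sub>L c n" "c n"] A cM
      by (simp add: M_compose blinfun_compose_assoc)
    also have "\<dots> \<ge> 0"
      by (intro t_nonneg M_compose cM A positive_operator_conjugate csa M_bounded)
    finally show ?case
      using Suc A cM by (simp add: cSuc blinfun_compose_linear t_diff M_compose)
  qed (simp add: c0)
  have asa: "is_adjoint A A"
    by (rule positive_operator_self_adjoint[OF A(2)])
  \<comment> \<open>Expand the square of \<open>e A + c n\<close>, bound the mixed term by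
    \<open>decr\<close>, and let \<open>n\<close> tend to infinity, so that
    \<open>t ((c n)^2)\<close> disappears.\<close>
  have key: "0 \<le> e\<^sup>2 * t (A o\<^sub>L A) + 2 * e * t (A o\<^sub>L C)" if "e > 0" for e
  proof -
    have "0 \<le> e\<^sup>2 * t (A o\<^sub>L A) + 2 * e * t (A o\<^sub>L C) + t (c n o\<^sub>L c n)" for n
    proof -
      have "0 \<le> t ((e *\<^sub>R A + c n) o\<^sub>L (e *\<^sub>R A + c n))"
        by (intro t_square_nonneg is_adjoint_add is_adjoint_scaleR asa csa M_closed A cM)
      also have "\<dots> = e\<^sup>2 * t (A o\<^sub>L A) + 2 * e * t (A o\<^sub>L c n) + t (c n o\<^sub>L c n)"
        using A cM t_compose_commute[of A "c n"]
        by (simp add: blinfun_compose_linear t_add t_scaleR M_closed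
            power2_eq_square algebra_simps)
      finally show ?thesis
        using mult_left_mono[OF decr[of n], of "2 * e"] that by linarith
    qed
    then have "0 \<le> e\<^sup>2 * t (A o\<^sub>L A) + 2 * e * t (A o\<^sub>L C) + 0"
      by (intro LIMSEQ_le_const[OF tendsto_add[OF tendsto_const lim]]) auto
    then show ?thesis by simp
  qed
  show ?thesis
  proof (rule ccontr)
    define p where "p = t (A o\<^sub>L C)"
    define q where "q = t (A o\<^sub>L A)"
    assume "\<not> ?thesis"
    then have p: "p < 0" by (simp add: p_def)
    have q: "q \<ge> 0"
      unfolding q_def by (rule t_square_nonneg[OF A(1) asa])
    \<comment> \<open>For small \<open>e\<close> the linear term of \<open>key\<close> dominates.
      This choice gives \<open>e * q + 2 * p = p - e < 0\<close>; the added 1 keeps the denominator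
      positive when \<open>q = 0\<close>.\<close>
    define e where "e = - p / (q + 1)"
    have e: "e > 0" "e * (q + 1) = - p"
      using p q by (simp_all add: e_def divide_neg_pos)
    have "0 \<le> e * (e * q + 2 * p)"
      using key[OF e(1)] by (simp add: p_def q_def power2_eq_square algebra_simps)
    then have "0 \<le> e * q + 2 * p"
      using e(1) by (simp add: zero_le_mult_iff)
    then show False
      using e p by (simp add: algebra_simps)
  qed
qed

text \<open>Pairing a positive operator with \<open>A - A^2\<close>, and then with
  \<open>B - B^2\<close>, gives \<open>t (A^2 B^2) \<le> t (A^2 B) \<le> t (A B) = 0\<close>. By the
  trace property the left side is the trace of \<open>(B A) (A B)\<close>, where \<open>B A\<close>
  is the adjoint of \<open>A B\<close>, so faithfulness applies.\<close>

lemma compose_eq_0_unit: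
  assumes A: "A \<in> M" "unit_interval A" and B: "B \<in> M" "unit_interval B"
    and 0: "t (A o\<^sub>L B) = 0"
  shows "A o\<^sub>L B = 0"
proof -
  have pos: "positive_operator A" "positive_operator B"
    using A B by (simp_all add: unit_interval_def)
  note sa = pos[THEN positive_operator_self_adjoint]
  note in_M = A(1) B(1)
  have "0 \<le> t (B o\<^sub>L (A - (A o\<^sub>L A)))"
    by (intro t_compose_nonneg_unit unit_interval_diff_square in_M M_closed pos A)
  then have 1: "t ((A o\<^sub>L A) o\<^sub>L B) \<le> 0"
    using 0 in_M t_compose_commute[of A B] t_compose_commute[of B "A o\<^sub>L A"]
    by (simp add: blinfun_compose_linear t_diff M_compose)
  have "0 \<le> t ((A o\<^sub>L A) o\<^sub>L (B - (B o\<^sub>L B)))"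
    by (intro t_compose_nonneg_unit unit_interval_diff_square in_M M_closed B
        positive_operator_square sa M_bounded)
  then have "t ((A o\<^sub>L A) o\<^sub>L (B o\<^sub>L B)) \<le> 0"
    using 1 in_M by (simp add: blinfun_compose_linear t_diff M_compose)
  moreover have "t ((A o\<^sub>L A) o\<^sub>L (B o\<^sub>L B)) = t ((B o\<^sub>L A) o\<^sub>L (A o\<^sub>L B))"
    using in_M t_compose_commute[of "(A o\<^sub>L A) o\<^sub>L B" B]
    by (simp add: M_compose blinfun_compose_assoc)
  moreover have adj: "is_adjoint (B o\<^sub>L A) (A o\<^sub>L B)"
    using sa by (simp add: is_adjoint_compose)
  then have "t ((B o\<^sub>L A) o\<^sub>L (A o\<^sub>L B)) \<ge> 0"
    by (intro t_nonneg positive_operator_square M_bounded M_compose in_M)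
  ultimately show ?thesis
    using in_M adj by (intro t_square_faithful[of _ "B o\<^sub>L A"]) (simp_all add: M_compose)
qed

text \<open>Hypothesis and conclusion are both homogeneous in \<open>A\<close> and in
  \<open>B\<close>, so both operators may be rescaled into the unit interval.\<close>

lemma compose_eq_0:
  assumes A: "A \<in> M" "positive_operator A" and B: "B \<in> M" "positive_operator B"
    and 0: "t (A o\<^sub>L B) = 0"
  shows "A o\<^sub>L B = 0"
proof -
  obtain r s where r: "r > 0" "unit_interval (r *\<^sub>R A)" and s: "s > 0" "unit_interval (s *\<^sub>R B)"
    using A B obtain_unit_interval_scaling by metis
  have "t ((r *\<^sub>R A) o\<^sub>L (s *\<^sub>R B)) = 0"
    using A B 0 by (simp add: blinfun_compose_linear
        t_scaleR M_closed)
  then have "(r *\<^sub>R A) o\<^sub>L (s *\<^sub>R B) = 0"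
    using A B r s by (intro compose_eq_0_unit M_scaleR)
  then show ?thesis
    using r s by (simp add: blinfun_compose_linear)
qed

text \<open>For the self-adjoint combination \<open>X\<close> of the \<open>A i\<close>, bilinearity
  makes \<open>t (X^2)\<close> the squared norm of the same combination of the \<open>u i\<close>.
  It vanishes, and faithfulness gives \<open>X = 0\<close>.\<close>

lemma gram_relation:
  fixes u :: "'i \<Rightarrow> 'b::real_inner"
  assumes fin: "finite I"
    and A: "\<And>i. i \<in> I \<Longrightarrow> A i \<in> M" "\<And>i. i \<in> I \<Longrightarrow> is_adjoint (A i) (A i)"
    and gram: "\<And>i j. i \<in> I \<Longrightarrow> j \<in> I \<Longrightarrow> t (A i o\<^sub>L A j) = u i \<bullet> u j"
    and rel: "(\<Sum>i\<in>I. c i *\<^sub>R u i) = 0"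
  shows "(\<Sum>i\<in>I. c i *\<^sub>R A i) = 0"
proof -
  let ?X = "\<Sum>i\<in>I. c i *\<^sub>R A i"
  have X: "?X \<in> M"
    by (intro M_sum fin M_scaleR A)
  have sa: "is_adjoint ?X ?X"
    using fin A(2)
  proof (induction I rule: finite_induct)
    case empty
    show ?case by (simp add: is_adjoint_zero)
  next
    case (insert i I)
    then show ?case by (simp add: is_adjoint_add is_adjoint_scaleR)
  qed
  have X2: "?X o\<^sub>L ?X = (\<Sum>i\<in>I. \<Sum>j\<in>I. c i *\<^sub>R c j *\<^sub>R (A i o\<^sub>L A j))"
    by (subst sum.swap) (simp add: blinfun_compose_linear scaleR_sum_right mult.commute)
  have "t (?X o\<^sub>L ?X) = (\<Sum>i\<in>I. \<Sum>j\<in>I. c i * (c j * t (A i o\<^sub>L A j)))"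
    using fin A by (simp add: X2 t_sum t_scaleR M_closed del: scaleR_scaleR)
  also have "\<dots> = (\<Sum>i\<in>I. c i *\<^sub>R u i) \<bullet> (\<Sum>i\<in>I. c i *\<^sub>R u i)"
    by (simp add: gram inner_sum_left inner_sum_right sum_distrib_left inner_commute
        mult.left_commute)
  finally show ?thesis
    using rel X sa by (intro t_square_faithful[of ?X ?X]) simp_all
qed

end

section \<open>The configuration\<close>

lemma atLeast0AtMost_4: "{0..4::nat} = {0, 1, 2, 3, 4}"
  by auto

text \<open>Lets the entries of \<open>W\<close> cancel against the normalizing factors of the
  vectors.\<close>

lemma sqrt6: "sqrt 6 = sqrt 2 * sqrt 3"
  by (simp flip: real_sqrt_mult)

lemma W_gram: "\<forall>i\<in>{0..4}. \<forall>j\<in>{0..4}. W i j = v i \<bullet> v j"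
  unfolding atLeast0AtMost_4
  by (simp add: W_def v_def inner_vec_def sum_3 vector_3 sqrt6 eval_nat_numeral)

text \<open>The expansion of \<open>v 1\<close> in the basis \<open>v 0\<close>, \<open>v 2\<close>,
  \<open>v 3\<close>. Since \<open>v 0\<close> and \<open>v 1\<close> are orthogonal to
  \<open>v 3\<close>, multiplying the operator version by \<open>A 3\<close> will leave only two
  terms.\<close>

lemma v_relation_1:
  "(\<Sum>i\<in>{0..4}. ((\<lambda>_. 0)(0 := - 2 / sqrt 6, 1 := 1, 2 := - 2 / 3, 3 := 1 / 3)) i *\<^sub>R v i) = 0"
  unfolding atLeast0AtMost_4
  by (simp add: v_def vec_eq_iff forall_3 vector_3 sqrt6 eval_nat_numeral field_simps)

text \<open>The expansion of \<open>v 4\<close> in the same basis. Here \<open>v 0\<close> and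
  \<open>v 4\<close> are orthogonal to \<open>v 2\<close>, so \<open>A 2\<close> is the
  multiplier.\<close>

lemma v_relation_4:
  "(\<Sum>i\<in>{0..4}. ((\<lambda>_. 0)(0 := - 1 / 3, 2 := 4 / (3 * sqrt 6), 3 := - 8 / (3 * sqrt 6), 4 := 1)) i
      *\<^sub>R v i) = 0"
  unfolding atLeast0AtMost_4
  by (simp add: v_def vec_eq_iff forall_3 vector_3 sqrt6 eval_nat_numeral field_simps)

theorem theorem6p3:
  shows "(\<forall>i\<in>{0..4}. \<forall>j\<in>{0..4}. W i j = v i \<bullet> v j) \<and>
    \<not> (\<exists>(M :: ('h::complex_hilbert_space \<Rightarrow>\<^sub>L 'h) set) (\<tau> :: ('h \<Rightarrow>\<^sub>L 'h) \<Rightarrow> complex)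
          (A :: nat \<Rightarrow> 'h \<Rightarrow>\<^sub>L 'h).
        finite_von_neumann_algebra M \<tau> \<and>
        (\<forall>i\<in>{0..4}. A i \<in> M \<and> positive_operator (A i)) \<and>
        (\<forall>i\<in>{0..4}. \<forall>j\<in>{0..4}. complex_of_real (W i j) = \<tau> (A i o\<^sub>L A j)))"
proof (intro conjI W_gram notI, elim exE conjE)
  fix M :: "('h \<Rightarrow>\<^sub>L 'h) set" and \<tau> and A :: "nat \<Rightarrow> 'h \<Rightarrow>\<^sub>L 'h"
  assume fin: "finite_von_neumann_algebra M \<tau>"
    and A: "\<forall>i\<in>{0..4}. A i \<in> M \<and> positive_operator (A i)"
    and tr: "\<forall>i\<in>{0..4}. \<forall>j\<in>{0..4}. complex_of_real (W i j) = \<tau> (A i o\<^sub>L A j)"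
  interpret finite_vna M \<tau>
    by unfold_locales (rule fin)
  have AM: "A i \<in> M" and Apos: "positive_operator (A i)" and Asa: "is_adjoint (A i) (A i)"
    if "i \<in> {0..4}" for i
    using that A positive_operator_self_adjoint by blast+
  have tW: "t (A i o\<^sub>L A j) = W i j" if "i \<in> {0..4}" "j \<in> {0..4}" for i j
    using tr that by (metis t_def Re_complex_of_real)
  have orth: "A i o\<^sub>L A j = 0" if "i \<in> {0..4}" "j \<in> {0..4}" "W i j = 0" for i j
    using that by (intro compose_eq_0 AM Apos) (simp_all add: tW)
  have relation: "(\<Sum>i\<in>{0..4}. c i *\<^sub>R A i) = 0" if "(\<Sum>i\<in>{0..4}. c i *\<^sub>R v i) = 0" for c
    using AM Asa that by (intro gram_relation[where u = v]) (simp_all add: tW W_gram)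
  define P where "P = A 2"
  define Q where "Q = A 3"
  have PQ: "2 *\<^sub>R (P o\<^sub>L Q) = Q o\<^sub>L Q"
  proof -
    have zero: "A 0 o\<^sub>L Q = 0" "A 1 o\<^sub>L Q = 0"
      unfolding Q_def by (rule orth; simp add: W_def eval_nat_numeral)+
    have "A 1 - (2 / sqrt 6) *\<^sub>R A 0 - (2 / 3) *\<^sub>R P + (1 / 3) *\<^sub>R Q = 0"
      using relation[OF v_relation_1] unfolding atLeast0AtMost_4 P_def Q_def by (simp add: algebra_simps)
    then have "(A 1 - (2 / sqrt 6) *\<^sub>R A 0 - (2 / 3) *\<^sub>R P + (1 / 3) *\<^sub>R Q) o\<^sub>L Q = 0"
      by simp
    then have "(1 / 3) *\<^sub>R ((Q o\<^sub>L Q) - 2 *\<^sub>R (P o\<^sub>L Q)) = 0"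
      by (simp add: blinfun_compose_linear zero algebra_simps del: One_nat_def)
    then show ?thesis by simp
  qed
  have QP: "2 *\<^sub>R (Q o\<^sub>L P) = P o\<^sub>L P"
  proof -
    have zero: "A 0 o\<^sub>L P = 0" "A 4 o\<^sub>L P = 0"
      unfolding P_def by (rule orth; simp add: W_def eval_nat_numeral)+
    have "A 4 - (1 / 3) *\<^sub>R A 0 + (4 / (3 * sqrt 6)) *\<^sub>R P - (8 / (3 * sqrt 6)) *\<^sub>R Q = 0"
      using relation[OF v_relation_4] unfolding atLeast0AtMost_4 P_def Q_def by (simp add: algebra_simps)
    then have "(A 4 - (1 / 3) *\<^sub>R A 0 + (4 / (3 * sqrt 6)) *\<^sub>R P - (8 / (3 * sqrt 6)) *\<^sub>R Q) o\<^sub>L P = 0"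
      by simp
    then have "(4 / (3 * sqrt 6)) *\<^sub>R ((P o\<^sub>L P) - 2 *\<^sub>R (Q o\<^sub>L P)) = 0"
      by (simp add: blinfun_compose_linear zero algebra_simps)
    then show ?thesis by simp
  qed
  have sa: "is_adjoint P P" "is_adjoint Q Q"
    unfolding P_def Q_def by (simp_all add: Asa)
  \<comment> \<open>Take adjoints in \<open>PQ\<close>: the square of \<open>Q\<close> is
    self-adjoint, while the factors on the other side change places.\<close>
  have "2 *\<^sub>R (Q o\<^sub>L P) = Q o\<^sub>L Q"
    using sa PQ by (metis is_adjoint_unique is_adjoint_compose is_adjoint_scaleR)
  with QP have QQ: "Q o\<^sub>L Q = P o\<^sub>L P"
    by simp
  \<comment> \<open>Each factor 2 is absorbed by one use of \<open>PQ\<close>, so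
    \<open>4 P Q^2 = P Q^2\<close>. Replacing \<open>Q^2\<close> by \<open>P^2\<close> then forces
    \<open>P^3 = 0\<close>.\<close>
  have "4 *\<^sub>R (P o\<^sub>L (Q o\<^sub>L Q)) = 2 *\<^sub>R ((2 *\<^sub>R (P o\<^sub>L Q)) o\<^sub>L Q)"
    by (simp add: blinfun_compose_linear blinfun_compose_assoc)
  also have "\<dots> = 2 *\<^sub>R (P o\<^sub>L (P o\<^sub>L Q))"
    by (simp add: PQ QQ blinfun_compose_assoc)
  also have "\<dots> = P o\<^sub>L (2 *\<^sub>R (P o\<^sub>L Q))"
    by (simp add: blinfun_compose_linear)
  also have "\<dots> = P o\<^sub>L (Q o\<^sub>L Q)"
    by (simp add: PQ)
  finally have "4 *\<^sub>R (P o\<^sub>L (P o\<^sub>L P)) = 1 *\<^sub>R (P o\<^sub>L (P o\<^sub>L P))"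
    by (simp add: QQ)
  then have "P o\<^sub>L (P o\<^sub>L P) = 0"
    by (simp only: scaleR_cancel_right) simp
  \<comment> \<open>The fourth power is the square of the self-adjoint operator \<open>P^2\<close>,
    so its vanishing passes down to \<open>P^2\<close>, whose trace should be
    \<open>W 2 2 = 1\<close>.\<close>
  then have "(P o\<^sub>L P) o\<^sub>L (P o\<^sub>L P) = 0"
    by (simp add: blinfun_compose_assoc)
  then have "P o\<^sub>L P = 0"
    using sa by (meson adjoint_compose_eq_0D is_adjoint_compose)
  then have "W 2 2 = 0"
    using tW[of 2 2] by (simp add: P_def t_zero)
  then show False
    by (simp add: W_def eval_nat_numeral)
qed

end
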